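(* Let $G$ be a compact Lie group and let $f,g,h\colon X\to Y$ be $G$-maps between $G$-spaces, where $X\times X$ is completely normal and $X$ is Hausdorff (for instance, $X$ metrizable). Then $$D_G(f,g)\le D_G(f,h)+D_G(h,g).$$
   Context: $\simeq_G$ denotes $G$-homotopy. A space is completely normal if every pair of separated subsets ($\overline{A}\cap B=\varnothing=A\cap\overline{B}$) has disjoint open neighbourhoods. Equivariant homotopic distance: for $G$-maps $f,g\colon X\to Y$, $D_G(f,g)$ is the least integer $n\ge 0$ such that $X$ has an open cover $\{U_0,\dots,U_n\}$ by $G$-invariant open sets with $f|_{U_i}\simeq_G g|_{U_i}$ for all $0\le i\le n$; it is $\infty$ if no such $n$ exists. *)

theory Defs
  imports
    "HOL-Analysis.Analysis"
    "HOL-Library.Extended_Nat"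
    "HOL-Algebra.Group_Action"
begin

section \<open>Smooth maps between open sets of Euclidean spaces\<close>

text \<open>
  The model space is \<^term>\<open>Euclidean_space n\<close>, i.e. the functions \<open>nat \<Rightarrow> real\<close> supported on
  \<open>{..<n}\<close>. Unlike an index type this allows \<open>n = 0\<close>, so that finite groups are Lie groups.
\<close>

definition partial_deriv :: "nat \<Rightarrow> ((nat \<Rightarrow> real) \<Rightarrow> real) \<Rightarrow> (nat \<Rightarrow> real) \<Rightarrow> real" where
  "partial_deriv i f x = deriv (\<lambda>t. f (x(i := t))) (x i)"

text \<open>In the following, \<open>S\<close> is meant to be open in \<^term>\<open>Euclidean_space n\<close>.\<close>

primrec Ck_on :: "nat \<Rightarrow> nat \<Rightarrow> (nat \<Rightarrow> real) set \<Rightarrow> ((nat \<Rightarrow> real) \<Rightarrow> real) \<Rightarrow> bool" where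
  "Ck_on n 0 S f \<longleftrightarrow> continuous_map (subtopology (Euclidean_space n) S) euclideanreal f"
| "Ck_on n (Suc k) S f \<longleftrightarrow>
     continuous_map (subtopology (Euclidean_space n) S) euclideanreal f \<and>
     (\<forall>i<n. (\<forall>x\<in>S. (\<lambda>t. f (x(i := t))) differentiable at (x i)) \<and>
            Ck_on n k S (partial_deriv i f))"

definition smooth_on ::
  "nat \<Rightarrow> nat \<Rightarrow> (nat \<Rightarrow> real) set \<Rightarrow> ((nat \<Rightarrow> real) \<Rightarrow> (nat \<Rightarrow> real)) \<Rightarrow> bool" where
  "smooth_on m n S f \<longleftrightarrow> (\<forall>j<n. \<forall>k. Ck_on m k S (\<lambda>x. f x j))"


section \<open>Smooth manifolds and Lie groups\<close>

type_synonym 'a chart = "'a set \<times> ('a \<Rightarrow> nat \<Rightarrow> real)"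

definition chart_of :: "'a topology \<Rightarrow> nat \<Rightarrow> 'a chart \<Rightarrow> bool" where
  "chart_of M n = (\<lambda>(U, \<phi>).
     openin M U \<and> openin (Euclidean_space n) (\<phi> ` U) \<and>
     homeomorphic_map (subtopology M U) (subtopology (Euclidean_space n) (\<phi> ` U)) \<phi>)"

text \<open>Atlases are not required to be maximal.\<close>

definition smooth_manifold :: "'a topology \<Rightarrow> nat \<Rightarrow> 'a chart set \<Rightarrow> bool" where
  "smooth_manifold M n A \<longleftrightarrow>
     Hausdorff_space M \<and> second_countable M \<and>
     (\<forall>c\<in>A. chart_of M n c) \<and>
     (\<Union>(U, \<phi>)\<in>A. U) = topspace M \<and>
     (\<forall>(U, \<phi>)\<in>A. \<forall>(V, \<psi>)\<in>A. smooth_on n n (\<phi> ` (U \<inter> V)) (\<psi> \<circ> inv_into U \<phi>))"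

definition smooth_map ::
  "'a topology \<Rightarrow> nat \<Rightarrow> 'a chart set \<Rightarrow> 'b topology \<Rightarrow> nat \<Rightarrow> 'b chart set \<Rightarrow> ('a \<Rightarrow> 'b) \<Rightarrow> bool" where
  "smooth_map M m A N n B f \<longleftrightarrow>
     continuous_map M N f \<and>
     (\<forall>(U, \<phi>)\<in>A. \<forall>(V, \<psi>)\<in>B. smooth_on m n (\<phi> ` (U \<inter> f -` V)) (\<psi> \<circ> f \<circ> inv_into U \<phi>))"

text \<open>
  Charts of a product manifold take values in \<^term>\<open>Euclidean_space (m + n)\<close>: the first \<open>m\<close>
  coordinates belong to the first factor, the next \<open>n\<close> to the second.
\<close>

definition product_atlas :: "nat \<Rightarrow> 'a chart set \<Rightarrow> 'b chart set \<Rightarrow> ('a \<times> 'b) chart set" where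
  "product_atlas m A B =
     (\<lambda>((U, \<phi>), (V, \<psi>)). (U \<times> V, \<lambda>(p, q) i. if i < m then \<phi> p i else \<psi> q (i - m))) ` (A \<times> B)"

definition Lie_group :: "('g, 'r) monoid_scheme \<Rightarrow> 'g topology \<Rightarrow> nat \<Rightarrow> 'g chart set \<Rightarrow> bool" where
  "Lie_group G T n A \<longleftrightarrow>
     group G \<and> topspace T = carrier G \<and> smooth_manifold T n A \<and>
     smooth_map (prod_topology T T) (n + n) (product_atlas n A A) T n A
       (\<lambda>(a, b). a \<otimes>\<^bsub>G\<^esub> b) \<and>
     smooth_map T n A T n A (\<lambda>a. inv\<^bsub>G\<^esub> a)"

definition compact_Lie_group ::
  "('g, 'r) monoid_scheme \<Rightarrow> 'g topology \<Rightarrow> nat \<Rightarrow> 'g chart set \<Rightarrow> bool" where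
  "compact_Lie_group G T n A \<longleftrightarrow> Lie_group G T n A \<and> compact_space T"


section \<open>G-spaces, G-maps and G-homotopies\<close>

definition G_space ::
  "('g, 'r) monoid_scheme \<Rightarrow> 'g topology \<Rightarrow> 'x topology \<Rightarrow> ('g \<Rightarrow> 'x \<Rightarrow> 'x) \<Rightarrow> bool" where
  "G_space G T X \<alpha> \<longleftrightarrow>
     group_action G (topspace X) \<alpha> \<and>
     continuous_map (prod_topology T X) X (\<lambda>(a, x). \<alpha> a x)"

definition equivariant_on ::
  "('g, 'r) monoid_scheme \<Rightarrow> ('g \<Rightarrow> 'x \<Rightarrow> 'x) \<Rightarrow> ('g \<Rightarrow> 'y \<Rightarrow> 'y) \<Rightarrow> 'x set \<Rightarrow> ('x \<Rightarrow> 'y) \<Rightarrow> bool" where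
  "equivariant_on G \<alpha> \<beta> S f \<longleftrightarrow> (\<forall>a\<in>carrier G. \<forall>x\<in>S. f (\<alpha> a x) = \<beta> a (f x))"

definition G_map ::
  "('g, 'r) monoid_scheme \<Rightarrow> 'x topology \<Rightarrow> ('g \<Rightarrow> 'x \<Rightarrow> 'x) \<Rightarrow> 'y topology \<Rightarrow> ('g \<Rightarrow> 'y \<Rightarrow> 'y) \<Rightarrow>
   ('x \<Rightarrow> 'y) \<Rightarrow> bool" where
  "G_map G X \<alpha> Y \<beta> f \<longleftrightarrow> continuous_map X Y f \<and> equivariant_on G \<alpha> \<beta> (topspace X) f"

text \<open>A G-homotopy is a homotopy through equivariant maps, i.e. \<open>G\<close> acts trivially on \<open>[0, 1]\<close>.\<close>

definition G_homotopic ::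
  "('g, 'r) monoid_scheme \<Rightarrow> 'x topology \<Rightarrow> ('g \<Rightarrow> 'x \<Rightarrow> 'x) \<Rightarrow> 'y topology \<Rightarrow> ('g \<Rightarrow> 'y \<Rightarrow> 'y) \<Rightarrow>
   ('x \<Rightarrow> 'y) \<Rightarrow> ('x \<Rightarrow> 'y) \<Rightarrow> bool" where
  "G_homotopic G X \<alpha> Y \<beta> f g \<longleftrightarrow>
     homotopic_with (equivariant_on G \<alpha> \<beta> (topspace X)) X Y f g"

definition G_invariant :: "('g, 'r) monoid_scheme \<Rightarrow> ('g \<Rightarrow> 'x \<Rightarrow> 'x) \<Rightarrow> 'x set \<Rightarrow> bool" where
  "G_invariant G \<alpha> S \<longleftrightarrow> (\<forall>a\<in>carrier G. \<forall>x\<in>S. \<alpha> a x \<in> S)"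


section \<open>Equivariant homotopic distance\<close>

text \<open>The infimum of the empty set in \<^typ>\<open>enat\<close> is \<open>\<infinity>\<close>.\<close>

definition G_homotopic_distance ::
  "('g, 'r) monoid_scheme \<Rightarrow> 'x topology \<Rightarrow> ('g \<Rightarrow> 'x \<Rightarrow> 'x) \<Rightarrow> 'y topology \<Rightarrow> ('g \<Rightarrow> 'y \<Rightarrow> 'y) \<Rightarrow>
   ('x \<Rightarrow> 'y) \<Rightarrow> ('x \<Rightarrow> 'y) \<Rightarrow> enat" where
  "G_homotopic_distance G X \<alpha> Y \<beta> f g =
     Inf {enat n | n. \<exists>U :: nat \<Rightarrow> 'x set.
       (\<forall>i\<le>n. openin X (U i) \<and> G_invariant G \<alpha> (U i) \<and>
              G_homotopic G (subtopology X (U i)) \<alpha> Y \<beta> f g) \<and>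
       (\<Union>i\<le>n. U i) = topspace X}"


section \<open>Completely normal spaces\<close>

definition completely_normal_space :: "'a topology \<Rightarrow> bool" where
  "completely_normal_space X \<longleftrightarrow>
     (\<forall>A B. separatedin X A B \<longrightarrow>
        (\<exists>U V. openin X U \<and> openin X V \<and> A \<subseteq> U \<and> B \<subseteq> V \<and> disjnt U V))"

end

theory Submission
  imports Defs
begin

text \<open>
  Let \<open>f\<close> and \<open>h\<close> be \<open>G\<close>-homotopic on each of \<open>U\<^sub>0, \<dots>, U\<^sub>m\<close>, and \<open>h\<close> and \<open>g\<close> on each of
  \<open>V\<^sub>0, \<dots>, V\<^sub>n\<close>. By transitivity \<open>f\<close> and \<open>g\<close> are \<open>G\<close>-homotopic on every \<open>U\<^sub>i \<inter> V\<^sub>j\<close>, but these are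
  \<open>(m + 1)(n + 1)\<close> sets, and only \<open>m + n + 1\<close> are allowed. The remedy is to merge pieces that can be
  made disjoint, since homotopies on disjoint open sets glue without any compatibility condition.

  Sort the points by the pair \<open>(i, j)\<close> of the first \<open>i\<close> with \<open>x \<in> U\<^sub>i\<close> and the first \<open>j\<close> with
  \<open>x \<in> V\<^sub>j\<close>. Two different pairs with the same sum \<open>k = i + j\<close> are incomparable, that is, one has the
  smaller \<open>i\<close> and the other the smaller \<open>j\<close>. So the stratum of each is contained in an open set that
  the other avoids, and hence avoids with its closure: the strata with index sum \<open>k\<close> are
  pairwise separated (\<open>separatedin_first_index_strata\<close>). Complete normality thickens them to
  disjoint open sets inside the \<open>U\<^sub>i \<inter> V\<^sub>j\<close> (\<open>completely_normal_space_separated_family\<close>), and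
  compactness of \<open>G\<close> shrinks these to invariant open sets that still contain the invariant strata
  (\<open>openin_invariant_core\<close>). The union \<open>W\<^sub>k\<close> of the thickened strata with \<open>i + j = k\<close>
  carries a \<open>G\<close>-homotopy from \<open>f\<close> to \<open>g\<close>, and \<open>W\<^sub>0, \<dots>, W\<^sub>m\<^sub>+\<^sub>n\<close> cover \<open>X\<close>.

  Complete normality is used on \<open>X\<close> itself, which inherits it from \<open>X \<times> X\<close> as a slice.
\<close>

section \<open>Completely normal spaces\<close>

text \<open>
  A nonempty \<open>Y\<close> gives a slice \<open>X \<times> {y}\<close>, a copy of \<open>X\<close> in \<open>X \<times> Y\<close>. The
  closure of \<open>A \<times> {y}\<close> is the product of the closures, so it meets the slice exactly in the copy
  of the closure of \<open>A\<close>, and separated sets stay separated.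
\<close>

lemma completely_normal_space_prod_topology_fst:
  assumes cn: "completely_normal_space (prod_topology X Y)" and y: "y \<in> topspace Y"
  shows "completely_normal_space X"
  unfolding completely_normal_space_def
proof (intro allI impI)
  fix A B assume sep: "separatedin X A B"
  have sep': "separatedin (prod_topology X Y) (A \<times> {y}) (B \<times> {y})"
    using sep y by (auto simp: separatedin_def closure_of_Times)
  obtain U V where UV: "openin (prod_topology X Y) U" "openin (prod_topology X Y) V"
      "A \<times> {y} \<subseteq> U" "B \<times> {y} \<subseteq> V" "disjnt U V"
    using cn[unfolded completely_normal_space_def, rule_format, OF sep'] by metis
  have slice: "openin X {x \<in> topspace X. (x, y) \<in> W}" if "openin (prod_topology X Y) W" for W
    by (rule openin_continuous_map_preimage[OF _ that]) (simp add: continuous_map_pairedI y)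
  show "\<exists>U V. openin X U \<and> openin X V \<and> A \<subseteq> U \<and> B \<subseteq> V \<and> disjnt U V"
    using slice[OF UV(1)] slice[OF UV(2)] UV(3-5) sep
    by (intro exI[of _ "{x \<in> topspace X. (x, y) \<in> U}"] exI[of _ "{x \<in> topspace X. (x, y) \<in> V}"])
       (auto simp: disjnt_def separatedin_def)
qed

lemma completely_normal_space_of_square:
  assumes "completely_normal_space (prod_topology X X)"
  shows "completely_normal_space X"
proof (cases "topspace X = {}")
  case True
  then show ?thesis
    unfolding completely_normal_space_def separatedin_def
    by (metis disjnt_empty1 openin_empty subset_empty)
next
  case False
  then obtain x where "x \<in> topspace X"
    by blast
  with assms show ?thesis
    by (rule completely_normal_space_prod_topology_fst)
qed

text \<open>
  Each member is intersected over all pairs in which it occurs; finiteness keeps the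
  intersection open.
\<close>

lemma completely_normal_space_separated_family:
  assumes cn: "completely_normal_space X" and fin: "finite I"
    and sub: "\<And>i. i \<in> I \<Longrightarrow> S i \<subseteq> topspace X"
    and sep: "pairwise (\<lambda>i j. separatedin X (S i) (S j)) I"
  obtains N where "\<And>i. i \<in> I \<Longrightarrow> openin X (N i)" and "\<And>i. i \<in> I \<Longrightarrow> S i \<subseteq> N i"
    and "pairwise (\<lambda>i j. disjnt (N i) (N j)) I"
proof -
  have "\<forall>i j. \<exists>P Q. i \<in> I \<longrightarrow> j \<in> I \<longrightarrow> i \<noteq> j \<longrightarrow>
      openin X P \<and> openin X Q \<and> S i \<subseteq> P \<and> S j \<subseteq> Q \<and> disjnt P Q"
    using cn sep unfolding completely_normal_space_def pairwise_def by meson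
  then obtain P Q where PQ: "\<And>i j. i \<in> I \<Longrightarrow> j \<in> I \<Longrightarrow> i \<noteq> j \<Longrightarrow>
      openin X (P i j) \<and> openin X (Q i j) \<and> S i \<subseteq> P i j \<and> S j \<subseteq> Q i j \<and> disjnt (P i j) (Q i j)"
    by metis
  \<comment> \<open>The factor \<open>topspace X\<close> matters only for a one-element \<open>I\<close>, where the intersection is over the
      empty family.\<close>
  define N where "N i = topspace X \<inter> (\<Inter>j\<in>I - {i}. P i j \<inter> Q j i)" for i
  show thesis
  proof (rule that[of N])
    fix i assume i: "i \<in> I"
    show "openin X (N i)"
    proof (cases "I - {i} = {}")
      case False
      then show ?thesis
        unfolding N_def using fin i PQ by (intro openin_Int openin_INT2) auto
    qed (simp only: N_def INF_empty Int_UNIV_right openin_topspace)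
    show "S i \<subseteq> N i"
      using i sub PQ unfolding N_def by blast
  next
    show "pairwise (\<lambda>i j. disjnt (N i) (N j)) I"
      unfolding pairwise_def
    proof (intro ballI impI)
      fix i j assume ij: "i \<in> I" "j \<in> I" "i \<noteq> j"
      then have "N i \<subseteq> P i j" "N j \<subseteq> Q i j"
        unfolding N_def by auto
      then show "disjnt (N i) (N j)"
        using PQ[OF ij] by (meson disjnt_subset1 disjnt_subset2)
    qed
  qed
qed

section \<open>Strata of a pair of covers\<close>

text \<open>
  The points whose first index in \<open>U\<close> is \<open>i\<close> and whose first index in \<open>V\<close> is \<open>j\<close>.
\<close>

definition first_index_stratum ::
    "(nat \<Rightarrow> 'a set) \<Rightarrow> (nat \<Rightarrow> 'a set) \<Rightarrow> nat \<Rightarrow> nat \<Rightarrow> 'a set" where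
  "first_index_stratum U V i j = (U i - (\<Union>i'<i. U i')) \<inter> (V j - (\<Union>j'<j. V j'))"

lemma first_index_stratum_covers:
  assumes "x \<in> (\<Union>i\<le>m. U i)" and "x \<in> (\<Union>j\<le>n. V j)"
  obtains i j where "i \<le> m" and "j \<le> n" and "x \<in> first_index_stratum U V i j"
proof -
  have first: "\<exists>i\<le>m. x \<in> U i - (\<Union>i'<i. U i')" if x: "x \<in> (\<Union>i\<le>m. U i)"
    for U :: "nat \<Rightarrow> 'a set" and m
  proof -
    obtain k where k: "k \<le> m" "x \<in> U k" using x by auto
    define l where "l = (LEAST i. x \<in> U i)"
    have "x \<in> U l" "l \<le> k"
      unfolding l_def using k(2) by (auto intro: LeastI Least_le)
    moreover have "x \<notin> U i'" if "i' < l" for i'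
      using that not_less_Least unfolding l_def by blast
    ultimately show ?thesis using k(1) by (intro exI[of _ l]) auto
  qed
  show thesis
    using first[OF assms(1)] first[OF assms(2)] that unfolding first_index_stratum_def by blast
qed

text \<open>
  If \<open>i < i'\<close> and \<open>j' < j\<close>, then the open set \<open>U i\<close> contains the first stratum and misses the
  second, and \<open>V j'\<close> does the reverse.
\<close>

lemma separatedin_first_index_strata:
  assumes U: "openin X (U i)" "openin X (U i')" and V: "openin X (V j)" "openin X (V j')"
    and ind: "i < i'" "j' < j"
  shows "separatedin X (first_index_stratum U V i j) (first_index_stratum U V i' j')"
proof -
  let ?S = "first_index_stratum U V i j" and ?S' = "first_index_stratum U V i' j'"
  have S: "?S \<subseteq> topspace X" "?S' \<subseteq> topspace X"
    using openin_subset[OF U(1)] openin_subset[OF U(2)] unfolding first_index_stratum_def by auto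
  have "U i \<inter> ?S' = {}" "?S \<subseteq> U i" "V j' \<inter> ?S = {}" "?S' \<subseteq> V j'"
    using ind unfolding first_index_stratum_def by auto
  then have "U i \<inter> X closure_of ?S' = {}" "?S \<subseteq> U i" "V j' \<inter> X closure_of ?S = {}" "?S' \<subseteq> V j'"
    using U V by (auto simp: openin_Int_closure_of_eq_empty)
  then show ?thesis
    using S unfolding separatedin_def by blast
qed

section \<open>Invariant open sets\<close>

lemma G_space_action_closed:
  assumes "G_space G T X \<alpha>" "a \<in> carrier G" "x \<in> topspace X"
  shows "\<alpha> a x \<in> topspace X"
  using assms group_action.element_image unfolding G_space_def by fastforce

lemma G_invariant_Int:
  "G_invariant G \<alpha> S \<Longrightarrow> G_invariant G \<alpha> S' \<Longrightarrow> G_invariant G \<alpha> (S \<inter> S')"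
  unfolding G_invariant_def by blast

lemma G_invariant_UN:
  "(\<And>i. i \<in> I \<Longrightarrow> G_invariant G \<alpha> (S i)) \<Longrightarrow> G_invariant G \<alpha> (\<Union>i\<in>I. S i)"
  unfolding G_invariant_def by blast

lemma G_invariant_Diff:
  assumes act: "group_action G E \<alpha>"
    and S: "G_invariant G \<alpha> S" "S \<subseteq> E" and S': "G_invariant G \<alpha> S'"
  shows "G_invariant G \<alpha> (S - S')"
  unfolding G_invariant_def
proof (intro ballI)
  fix a x assume a: "a \<in> carrier G" and x: "x \<in> S - S'"
  interpret group_action G E \<alpha> by (rule act)
  interpret group_hom G "BijGroup E" \<alpha> by (rule group_hom)
  have "\<alpha> (inv\<^bsub>G\<^esub> a) (\<alpha> a x) = x"
    using orbit_sym_aux[OF a, of x] x S(2) by auto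
  then show "\<alpha> a x \<in> S - S'"
    using a x S S' G.inv_closed[OF a] unfolding G_invariant_def by (metis Diff_iff)
qed

lemma G_invariant_first_index_stratum:
  assumes "group_action G E \<alpha>"
    and "\<And>i'. i' \<le> i \<Longrightarrow> G_invariant G \<alpha> (U i')" "U i \<subseteq> E"
    and "\<And>j'. j' \<le> j \<Longrightarrow> G_invariant G \<alpha> (V j')" "V j \<subseteq> E"
  shows "G_invariant G \<alpha> (first_index_stratum U V i j)"
  unfolding first_index_stratum_def using assms
  by (intro G_invariant_Int G_invariant_Diff[OF assms(1)] G_invariant_UN) auto

definition invariant_core ::
    "('g, 'r) monoid_scheme \<Rightarrow> 'x topology \<Rightarrow> ('g \<Rightarrow> 'x \<Rightarrow> 'x) \<Rightarrow> 'x set \<Rightarrow> 'x set" where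
  "invariant_core G X \<alpha> W = {x \<in> topspace X. \<forall>a\<in>carrier G. \<alpha> a x \<in> W}"

lemma invariant_core_subset:
  assumes "G_space G T X \<alpha>"
  shows "invariant_core G X \<alpha> W \<subseteq> W"
proof
  interpret group_action G "topspace X" \<alpha>
    using assms unfolding G_space_def by blast
  interpret group_hom G "BijGroup (topspace X)" \<alpha> by (rule group_hom)
  fix x assume x: "x \<in> invariant_core G X \<alpha> W"
  have "\<alpha> \<one>\<^bsub>G\<^esub> x = (\<lambda>x\<in>topspace X. x) x"
    by (simp only: id_eq_one)
  with x have "\<alpha> \<one>\<^bsub>G\<^esub> x = x"
    by (simp add: invariant_core_def)
  then show "x \<in> W"
    using x G.one_closed unfolding invariant_core_def by fastforce
qed

lemma G_invariant_core:
  assumes "G_space G T X \<alpha>"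
  shows "G_invariant G \<alpha> (invariant_core G X \<alpha> W)"
  unfolding G_invariant_def
proof (intro ballI)
  interpret group_action G "topspace X" \<alpha>
    using assms unfolding G_space_def by blast
  interpret group_hom G "BijGroup (topspace X)" \<alpha> by (rule group_hom)
  fix a x assume a: "a \<in> carrier G" and x: "x \<in> invariant_core G X \<alpha> W"
  then have xX: "x \<in> topspace X" by (simp add: invariant_core_def)
  have "\<alpha> b (\<alpha> a x) \<in> W" if b: "b \<in> carrier G" for b
  proof -
    have "\<alpha> b (\<alpha> a x) = \<alpha> (b \<otimes>\<^bsub>G\<^esub> a) x"
      using composition_rule[OF xX b a] by simp
    then show ?thesis using x G.m_closed[OF b a] by (simp add: invariant_core_def)
  qed
  then show "\<alpha> a x \<in> invariant_core G X \<alpha> W"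
    using G_space_action_closed[OF assms a xX] by (simp add: invariant_core_def)
qed

lemma subset_invariant_core:
  "G_invariant G \<alpha> S \<Longrightarrow> S \<subseteq> W \<Longrightarrow> S \<subseteq> topspace X \<Longrightarrow> S \<subseteq> invariant_core G X \<alpha> W"
  unfolding G_invariant_def invariant_core_def by blast

text \<open>
  The complement of the core is the projection to \<open>X\<close> of the closed set of all pairs \<open>(a, x)\<close> with
  \<open>\<alpha> a x\<close> outside \<open>W\<close>, and projection along a compact factor is a closed map.
\<close>

lemma openin_invariant_core:
  assumes sp: "G_space G T X \<alpha>" and comp: "compact_space T" and T: "topspace T = carrier G"
    and W: "openin X W"
  shows "openin X (invariant_core G X \<alpha> W)"
proof -
  let ?C = "{z \<in> topspace (prod_topology T X). (\<lambda>(a, x). \<alpha> a x) z \<in> topspace X - W}"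
  have "closedin (prod_topology T X) ?C"
    using sp W unfolding G_space_def by (intro closedin_continuous_map_preimage) auto
  then have closed: "closedin X (snd ` ?C)"
    using closed_map_snd[OF comp, of X] unfolding closed_map_def by blast
  have "invariant_core G X \<alpha> W = topspace X - snd ` ?C"
    using G_space_action_closed[OF sp] by (force simp: invariant_core_def T)
  then show ?thesis
    using closed by (simp add: openin_diff)
qed

section \<open>Restricting and gluing equivariant homotopies\<close>

text \<open>
  On an invariant set, equivariance only depends on the values there, so the endpoints of a
  \<open>G\<close>-homotopy need only be prescribed on that set.
\<close>

lemma G_homotopic_subtopology_iff:
  assumes "S \<subseteq> topspace X" and "G_invariant G \<alpha> S"
  shows "G_homotopic G (subtopology X S) \<alpha> Y \<beta> f g \<longleftrightarrow>
    (\<exists>H. continuous_map (prod_topology (top_of_set {0..1::real}) (subtopology X S)) Y H \<and>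
      (\<forall>x\<in>S. H (0, x) = f x) \<and> (\<forall>x\<in>S. H (1, x) = g x) \<and>
      (\<forall>t\<in>{0..1}. equivariant_on G \<alpha> \<beta> S (\<lambda>x. H (t, x))))"
proof -
  have S: "topspace (subtopology X S) = S"
    using assms(1) by auto
  have "equivariant_on G \<alpha> \<beta> S u \<longleftrightarrow> equivariant_on G \<alpha> \<beta> S v"
    if "\<And>x. x \<in> S \<Longrightarrow> u x = v x" for u v
    using that assms(2) unfolding equivariant_on_def G_invariant_def by simp
  then show ?thesis
    unfolding G_homotopic_def S by (rule homotopic_with[of "subtopology X S", unfolded S])
qed

lemma G_homotopic_trans:
  "G_homotopic G X \<alpha> Y \<beta> f h \<Longrightarrow> G_homotopic G X \<alpha> Y \<beta> h g \<Longrightarrow> G_homotopic G X \<alpha> Y \<beta> f g"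
  unfolding G_homotopic_def by (rule homotopic_with_trans)

lemma G_homotopic_subset:
  assumes hom: "G_homotopic G (subtopology X S) \<alpha> Y \<beta> f g" and "S' \<subseteq> S"
  shows "G_homotopic G (subtopology X S') \<alpha> Y \<beta> f g"
proof -
  have "continuous_map (subtopology X S') (subtopology X S) id"
    using assms(2) by (auto simp: continuous_map_in_subtopology continuous_map_from_subtopology)
  with hom have "homotopic_with (equivariant_on G \<alpha> \<beta> (topspace (subtopology X S')))
      (subtopology X S') Y (f \<circ> id) (g \<circ> id)"
    unfolding G_homotopic_def
    by (rule homotopic_with_compose_continuous_map_right)
       (use assms(2) in \<open>auto simp: equivariant_on_def\<close>)
  then show ?thesis by (simp add: G_homotopic_def)
qed

text \<open>
  Every point lies in exactly one \<open>N i\<close>, and its whole orbit lies there too, so applying the homotopy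
  of that piece is equivariant; it is continuous because the pieces are open.
\<close>

lemma G_homotopic_disjoint_Union:
  assumes op: "\<And>i. i \<in> I \<Longrightarrow> openin X (N i)"
    and inv: "\<And>i. i \<in> I \<Longrightarrow> G_invariant G \<alpha> (N i)"
    and disj: "pairwise (\<lambda>i j. disjnt (N i) (N j)) I"
    and hom: "\<And>i. i \<in> I \<Longrightarrow> G_homotopic G (subtopology X (N i)) \<alpha> Y \<beta> f g"
  shows "G_homotopic G (subtopology X (\<Union>i\<in>I. N i)) \<alpha> Y \<beta> f g"
proof -
  let ?N = "\<Union>i\<in>I. N i" and ?J = "top_of_set {0..1::real}"
  have sub: "N i \<subseteq> topspace X" if "i \<in> I" for i
    using op[OF that] by (rule openin_subset)
  have "\<forall>i\<in>I. \<exists>H. continuous_map (prod_topology ?J (subtopology X (N i))) Y H \<and>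
      (\<forall>x\<in>N i. H (0, x) = f x) \<and> (\<forall>x\<in>N i. H (1, x) = g x) \<and>
      (\<forall>t\<in>{0..1}. equivariant_on G \<alpha> \<beta> (N i) (\<lambda>x. H (t, x)))"
    using hom sub inv by (simp add: G_homotopic_subtopology_iff)
  then obtain H where
      cont: "\<And>i. i \<in> I \<Longrightarrow> continuous_map (prod_topology ?J (subtopology X (N i))) Y (H i)"
      and ends: "\<And>i x. i \<in> I \<Longrightarrow> x \<in> N i \<Longrightarrow> H i (0, x) = f x \<and> H i (1, x) = g x"
      and equi: "\<And>i t. i \<in> I \<Longrightarrow> t \<in> {0..1} \<Longrightarrow> equivariant_on G \<alpha> \<beta> (N i) (\<lambda>x. H i (t, x))"
    by metis
  define piece where "piece x = (THE i. i \<in> I \<and> x \<in> N i)" for x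
  have piece: "piece x = i" if "i \<in> I" "x \<in> N i" for x i
    unfolding piece_def using that disj by (intro the_equality) (auto simp: pairwise_def disjnt_iff)
  define K where "K = (\<lambda>(t, x). H (piece x) (t, x))"
  have K: "K (t, x) = H i (t, x)" if "i \<in> I" "x \<in> N i" for t x i
    using piece[OF that] by (simp add: K_def)
  have "continuous_map (prod_topology ?J (subtopology X ?N)) Y K"
  proof (rule pasting_lemma[where T = "\<lambda>i. {0..1} \<times> N i" and f = H and I = I])
    fix i assume i: "i \<in> I"
    have "openin (subtopology X ?N) (N i)"
      using op[OF i] i by (auto simp: openin_subtopology_alt intro!: image_eqI[of _ _ "N i"])
    then show "openin (prod_topology ?J (subtopology X ?N)) ({0..1} \<times> N i)"
      by (simp add: openin_prod_Times_iff)
    have "?N \<inter> N i = N i" using i by blast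
    then have "subtopology (prod_topology ?J (subtopology X ?N)) ({0..1} \<times> N i)
        = prod_topology ?J (subtopology X (N i))"
      by (simp add: subtopology_Times subtopology_subtopology)
    then show "continuous_map (subtopology (prod_topology ?J (subtopology X ?N)) ({0..1} \<times> N i)) Y (H i)"
      using cont[OF i] by simp
  next
    fix i j z
    assume "i \<in> I" "j \<in> I"
      "z \<in> topspace (prod_topology ?J (subtopology X ?N)) \<inter> {0..1} \<times> N i \<inter> {0..1} \<times> N j"
    then show "H i z = H j z"
      using piece by (metis IntE SigmaE2 prod.collapse)
  next
    fix z assume "z \<in> topspace (prod_topology ?J (subtopology X ?N))"
    then show "\<exists>j. j \<in> I \<and> z \<in> {0..1} \<times> N j \<and> K z = H j z"
      using K by (cases z) auto
  qed
  moreover have "equivariant_on G \<alpha> \<beta> ?N (\<lambda>x. K (t, x))" if t: "t \<in> {0..1}" for t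
    unfolding equivariant_on_def
  proof (intro ballI)
    fix a x assume a: "a \<in> carrier G" and "x \<in> ?N"
    then obtain i where i: "i \<in> I" "x \<in> N i" by blast
    then have "\<alpha> a x \<in> N i" using inv a unfolding G_invariant_def by blast
    then show "K (t, \<alpha> a x) = \<beta> a (K (t, x))"
      using K i equi[OF i(1) t] a unfolding equivariant_on_def by simp
  qed
  moreover have "?N \<subseteq> topspace X" "G_invariant G \<alpha> ?N"
    using sub inv by (auto intro: G_invariant_UN)
  ultimately show ?thesis
    using K ends by (subst G_homotopic_subtopology_iff) auto
qed

section \<open>Equivariant homotopic distance\<close>

definition G_homotopy_cover ::
  "('g, 'r) monoid_scheme \<Rightarrow> 'x topology \<Rightarrow> ('g \<Rightarrow> 'x \<Rightarrow> 'x) \<Rightarrow> 'y topology \<Rightarrow> ('g \<Rightarrow> 'y \<Rightarrow> 'y) \<Rightarrow>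
   ('x \<Rightarrow> 'y) \<Rightarrow> ('x \<Rightarrow> 'y) \<Rightarrow> nat \<Rightarrow> (nat \<Rightarrow> 'x set) \<Rightarrow> bool" where
  "G_homotopy_cover G X \<alpha> Y \<beta> f g n U \<longleftrightarrow>
     (\<forall>i\<le>n. openin X (U i) \<and> G_invariant G \<alpha> (U i) \<and>
            G_homotopic G (subtopology X (U i)) \<alpha> Y \<beta> f g) \<and>
     (\<Union>i\<le>n. U i) = topspace X"

lemma G_homotopic_distance_eq_Inf:
  "G_homotopic_distance G X \<alpha> Y \<beta> f g = Inf {enat n | n. \<exists>U. G_homotopy_cover G X \<alpha> Y \<beta> f g n U}"
  unfolding G_homotopic_distance_def G_homotopy_cover_def ..

lemma G_homotopic_distance_le:
  "G_homotopy_cover G X \<alpha> Y \<beta> f g n U \<Longrightarrow> G_homotopic_distance G X \<alpha> Y \<beta> f g \<le> enat n"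
  unfolding G_homotopic_distance_eq_Inf by (intro Inf_lower) auto

lemma G_homotopic_distance_attained:
  assumes "G_homotopic_distance G X \<alpha> Y \<beta> f g = enat n"
  obtains U where "G_homotopy_cover G X \<alpha> Y \<beta> f g n U"
proof -
  let ?D = "{enat n | n. \<exists>U. G_homotopy_cover G X \<alpha> Y \<beta> f g n U}"
  have "Inf ?D = enat n"
    using assms by (simp add: G_homotopic_distance_eq_Inf)
  moreover from this have "?D \<noteq> {}"
    by (intro notI) (simp add: top_enat_def)
  then obtain l where "l \<in> ?D"
    by (auto simp only: ex_in_conv[symmetric])
  then have "Inf ?D \<in> ?D"
    by (rule wellorder_InfI)
  ultimately have "enat n \<in> ?D"
    by (simp only:)
  then show thesis using that by auto
qed

text \<open>
  Index sums run from \<open>0\<close> to \<open>m + n\<close>, whence the size of the new cover. For each sum the thickened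
  strata are cut down to \<open>U i \<inter> V j\<close>, where the homotopies through \<open>h\<close> exist, before the invariant
  core is taken.
\<close>

lemma G_homotopy_cover_combine:
  assumes sp: "G_space G T X \<alpha>" and comp: "compact_space T" and T: "topspace T = carrier G"
    and cn: "completely_normal_space X"
    and U: "G_homotopy_cover G X \<alpha> Y \<beta> f h m U"
    and V: "G_homotopy_cover G X \<alpha> Y \<beta> h g n V"
  obtains W where "G_homotopy_cover G X \<alpha> Y \<beta> f g (m + n) W"
proof -
  have act: "group_action G (topspace X) \<alpha>"
    using sp unfolding G_space_def by blast
  have U': "openin X (U i)" "G_invariant G \<alpha> (U i)" "U i \<subseteq> topspace X"
      "G_homotopic G (subtopology X (U i)) \<alpha> Y \<beta> f h" if "i \<le> m" for i
    using U that openin_subset[of X "U i"] unfolding G_homotopy_cover_def by simp_all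
  have V': "openin X (V j)" "G_invariant G \<alpha> (V j)" "V j \<subseteq> topspace X"
      "G_homotopic G (subtopology X (V j)) \<alpha> Y \<beta> h g" if "j \<le> n" for j
    using V that openin_subset[of X "V j"] unfolding G_homotopy_cover_def by simp_all
  have "\<exists>W. openin X W \<and> G_invariant G \<alpha> W \<and> G_homotopic G (subtopology X W) \<alpha> Y \<beta> f g \<and>
      (\<forall>i\<le>m. \<forall>j\<le>n. i + j = k \<longrightarrow> first_index_stratum U V i j \<subseteq> W)" for k
  proof -
    \<comment> \<open>The pairs \<open>(i, j)\<close> of sum \<open>k\<close>, indexed by \<open>i\<close>.\<close>
    define I where "I = {i. i \<le> m \<and> i \<le> k \<and> k - i \<le> n}"
    define S where "S i = first_index_stratum U V i (k - i)" for i
    have fin: "finite I" unfolding I_def by (rule finite_subset[of _ "{..m}"]) auto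
    have SUV: "S i \<subseteq> U i \<inter> V (k - i)" for i
      unfolding S_def first_index_stratum_def by blast
    have Ssub: "S i \<subseteq> topspace X" if "i \<in> I" for i
      using SUV U'(3) that unfolding I_def by blast
    have Sinv: "G_invariant G \<alpha> (S i)" if "i \<in> I" for i
      using that U' V' unfolding I_def S_def
      by (intro G_invariant_first_index_stratum[OF act]) auto
    have lt: "separatedin X (S i) (S i')" if "i \<in> I" "i' \<in> I" "i < i'" for i i'
      using that U' V' unfolding I_def S_def
      by (intro separatedin_first_index_strata) auto
    have "pairwise (\<lambda>i i'. separatedin X (S i) (S i')) I"
      unfolding pairwise_def using lt separatedin_sym by (metis linorder_neqE_nat)
    from completely_normal_space_separated_family[OF cn fin Ssub this]
    obtain N where N: "\<And>i. i \<in> I \<Longrightarrow> openin X (N i)" "\<And>i. i \<in> I \<Longrightarrow> S i \<subseteq> N i"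
        "pairwise (\<lambda>i j. disjnt (N i) (N j)) I"
      by blast
    define M where "M i = invariant_core G X \<alpha> (N i \<inter> (U i \<inter> V (k - i)))" for i
    have M: "M i \<subseteq> N i \<inter> (U i \<inter> V (k - i))" for i
      unfolding M_def by (rule invariant_core_subset[OF sp])
    have Mop: "openin X (M i)" if "i \<in> I" for i
      unfolding M_def using that N(1) U'(1) V'(1) unfolding I_def
      by (intro openin_invariant_core[OF sp comp T] openin_Int) auto
    have Minv: "G_invariant G \<alpha> (M i)" for i
      unfolding M_def by (rule G_invariant_core[OF sp])
    have SM: "S i \<subseteq> M i" if "i \<in> I" for i
      unfolding M_def using that Sinv Ssub N(2) SUV by (intro subset_invariant_core) auto
    have Mhom: "G_homotopic G (subtopology X (M i)) \<alpha> Y \<beta> f g" if i: "i \<in> I" for i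
    proof (rule G_homotopic_trans)
      show "G_homotopic G (subtopology X (M i)) \<alpha> Y \<beta> f h"
        using i M[of i] unfolding I_def by (intro G_homotopic_subset[OF U'(4)[of i]]) blast+
      show "G_homotopic G (subtopology X (M i)) \<alpha> Y \<beta> h g"
        using i M[of i] unfolding I_def by (intro G_homotopic_subset[OF V'(4)[of "k - i"]]) blast+
    qed
    have "pairwise (\<lambda>i j. disjnt (M i) (M j)) I"
      using N(3) M unfolding pairwise_def
      by (meson disjnt_subset1 disjnt_subset2 le_infE)
    then have "G_homotopic G (subtopology X (\<Union>i\<in>I. M i)) \<alpha> Y \<beta> f g"
      using Mop Minv Mhom by (intro G_homotopic_disjoint_Union)
    moreover have "openin X (\<Union>i\<in>I. M i)" "G_invariant G \<alpha> (\<Union>i\<in>I. M i)"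
      using Mop Minv by (auto intro: G_invariant_UN)
    moreover have "first_index_stratum U V i j \<subseteq> (\<Union>i\<in>I. M i)"
      if "i \<le> m" "j \<le> n" "i + j = k" for i j
    proof -
      have "i \<in> I" "j = k - i" using that unfolding I_def by auto
      then show ?thesis using SM[of i] unfolding S_def by blast
    qed
    ultimately show ?thesis by blast
  qed
  then obtain W where W: "\<And>k. openin X (W k)" "\<And>k. G_invariant G \<alpha> (W k)"
      "\<And>k. G_homotopic G (subtopology X (W k)) \<alpha> Y \<beta> f g"
      "\<And>i j. i \<le> m \<Longrightarrow> j \<le> n \<Longrightarrow> first_index_stratum U V i j \<subseteq> W (i + j)"
    by metis
  have "x \<in> (\<Union>k\<le>m + n. W k)" if x: "x \<in> topspace X" for x
  proof -
    have "x \<in> (\<Union>i\<le>m. U i)" "x \<in> (\<Union>j\<le>n. V j)"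
      using x U V unfolding G_homotopy_cover_def by auto
    then obtain i j where ij: "i \<le> m" "j \<le> n" "x \<in> first_index_stratum U V i j"
      by (rule first_index_stratum_covers)
    then show ?thesis using W(4)[OF ij(1,2)] by (intro UN_I[of "i + j"]) auto
  qed
  then have "(\<Union>k\<le>m + n. W k) = topspace X"
    using openin_subset[OF W(1)] by blast
  then have "G_homotopy_cover G X \<alpha> Y \<beta> f g (m + n) W"
    unfolding G_homotopy_cover_def using W(1-3) by blast
  then show thesis by (rule that)
qed

theorem theorem5p5:
  fixes G :: "('g, 'r) monoid_scheme" and TG :: "'g topology" and d :: nat and A :: "'g chart set"
    and X :: "'x topology" and \<alpha> :: "'g \<Rightarrow> 'x \<Rightarrow> 'x"
    and Y :: "'y topology" and \<beta> :: "'g \<Rightarrow> 'y \<Rightarrow> 'y"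
    and f g h :: "'x \<Rightarrow> 'y"
  assumes "compact_Lie_group G TG d A"
    and "G_space G TG X \<alpha>" and "G_space G TG Y \<beta>"
    and "G_map G X \<alpha> Y \<beta> f" and "G_map G X \<alpha> Y \<beta> g" and "G_map G X \<alpha> Y \<beta> h"
    and "completely_normal_space (prod_topology X X)"
    and "Hausdorff_space X"
  shows "G_homotopic_distance G X \<alpha> Y \<beta> f g
         \<le> G_homotopic_distance G X \<alpha> Y \<beta> f h + G_homotopic_distance G X \<alpha> Y \<beta> h g"
proof (cases "G_homotopic_distance G X \<alpha> Y \<beta> f h = \<infinity> \<or> G_homotopic_distance G X \<alpha> Y \<beta> h g = \<infinity>")
  case True
  then show ?thesis by auto
next
  case False
  then obtain m n where mn: "G_homotopic_distance G X \<alpha> Y \<beta> f h = enat m"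
      "G_homotopic_distance G X \<alpha> Y \<beta> h g = enat n"
    by auto
  obtain U V where "G_homotopy_cover G X \<alpha> Y \<beta> f h m U" "G_homotopy_cover G X \<alpha> Y \<beta> h g n V"
    using mn by (metis G_homotopic_distance_attained)
  moreover have "compact_space TG" "topspace TG = carrier G"
    using assms(1) unfolding compact_Lie_group_def Lie_group_def by blast+
  ultimately obtain W where "G_homotopy_cover G X \<alpha> Y \<beta> f g (m + n) W"
    using G_homotopy_cover_combine[OF assms(2)] completely_normal_space_of_square[OF assms(7)]
    by metis
  then show ?thesis
    using G_homotopic_distance_le mn by fastforce
qed

end
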